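(* Let $G$ be a finite abstract simplicial complex, and let $K$ be its counting matrix, with entries $K(x,y)=|W^-(x)\cap W^-(y)|$ for $x,y\in G$. Then the sum of all entries of the inverse matrix $K^{-1}$ equals the number of sets in $G$: $$\sum_{x\in G}\sum_{y\in G}K^{-1}(x,y)=|G|.$$
   Context: A finite abstract simplicial complex $G$ is a finite set of non-empty finite sets that is closed under taking non-empty subsets (the empty set is not an element of $G$). For $x\in G$, the core of $x$ is $W^-(x)=\{u\in G : u\subseteq x\}$, i.e. the set of all non-empty subsets of $x$. The counting matrix $K$ of $G$ has its rows and columns indexed by the elements of $G$ (in some fixed order, the same for rows and columns), with $K(x,y)=|W^-(x)\cap W^-(y)|=2^{|x\cap y|}-1$. The matrix $K$ has determinant $1$, hence is invertible, and $K^{-1}(x,y)$ denotes the entries of its inverse, indexed in the same way. *)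

theory Defs
  imports "Jordan_Normal_Form.Matrix"
begin

definition finite_simplicial_complex :: "'a set set \<Rightarrow> bool" where
  "finite_simplicial_complex G \<longleftrightarrow>
     finite G \<and>
     (\<forall>x\<in>G. finite x \<and> x \<noteq> {}) \<and>
     (\<forall>x\<in>G. \<forall>u. u \<subseteq> x \<and> u \<noteq> {} \<longrightarrow> u \<in> G)"

definition core :: "'a set set \<Rightarrow> 'a set \<Rightarrow> 'a set set" where
  "core G x = {u \<in> G. u \<subseteq> x}"

text \<open>
  Rows and columns are indexed by the elements of \<open>G\<close> through an enumeration \<open>xs\<close>
  (a distinct list with \<open>set xs = G\<close>): index \<open>i\<close> stands for the set \<open>xs ! i\<close>.
  The entries are integers, taken as reals so that the inverse lives over a field.
\<close>

definition counting_matrix :: "'a set set \<Rightarrow> 'a set list \<Rightarrow> real mat" where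
  "counting_matrix G xs =
     mat (length xs) (length xs)
       (\<lambda>(i, j). real (card (core G (xs ! i) \<inter> core G (xs ! j))))"

end

theory Submission
  imports Defs "Jordan_Normal_Form.Determinant"
begin

text \<open>
  Since \<open>G\<close> is closed under non-empty subsets, \<open>\<bar>W\<^sup>-(x) \<inter> W\<^sup>-(y)\<bar>\<close> counts the \<open>u \<in> G\<close> below
  both \<open>x\<close> and \<open>y\<close>, which says \<open>K = Z Z\<^sup>T\<close> for the zeta matrix \<open>Z(x,u) = [u \<subseteq> x]\<close>.
  The intervals of the inclusion order on \<open>G\<close> are Boolean lattices, so \<open>Z\<close> is inverted by the
  Moebius matrix \<open>M(x,u) = [u \<subseteq> x] (-1)\<^bsup>\<bar>x\<bar>+\<bar>u\<bar>\<^esup>\<close>, and therefore \<open>K\<^sup>-\<^sup>1 = M\<^sup>T M\<close>.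
  The sum of all entries of \<open>M\<^sup>T M\<close> is the sum of the squares of the row sums of \<open>M\<close>.
  The row of \<open>x\<close> sums \<open>(-1)\<^bsup>\<bar>x\<bar>+\<bar>u\<bar>\<^esup>\<close> over all subsets \<open>u\<close> of \<open>x\<close> except the empty one; with the empty
  set the sum would vanish, so the row sum is \<open>\<plusminus>1\<close>, and every element of \<open>G\<close> contributes exactly \<open>1\<close>.
  Both the inversion of \<open>Z\<close> and the row sums of \<open>M\<close> come from the alternating sum over an
  interval of sets, \<open>alternating_sum_interval\<close>.
\<close>

text \<open>
  Toggling a fixed element of \<open>x - y\<close> is an involution of the interval between \<open>y\<close> and \<open>x\<close> that
  reverses the sign of every term, so the sum equals its own negative unless \<open>x = y\<close>.
\<close>

lemma alternating_sum_interval: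
  assumes "finite x" and "y \<subseteq> x"
  shows "(\<Sum>u | y \<subseteq> u \<and> u \<subseteq> x. (-1) ^ card u) = (if x = y then (-1) ^ card x else (0 :: real))"
proof (cases "x = y")
  case True
  then have "{u. y \<subseteq> u \<and> u \<subseteq> x} = {x}" by auto
  with True show ?thesis by simp
next
  case False
  with assms obtain a where a: "a \<in> x" "a \<notin> y" by blast
  define t where "t u = (if a \<in> u then u - {a} else insert a u)" for u
  let ?S = "{u. y \<subseteq> u \<and> u \<subseteq> x}"
  have t_t: "t (t u) = u" for u by (auto simp: t_def)
  have t_mem: "y \<subseteq> t u \<and> t u \<subseteq> x" if "y \<subseteq> u \<and> u \<subseteq> x" for u
    using that a by (auto simp: t_def)
  have sign: "(-1) ^ card (t u) = - ((-1) ^ card u :: real)" if "u \<in> ?S" for u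
  proof -
    from that assms(1) have "finite u" using finite_subset by blast
    show ?thesis
    proof (cases "a \<in> u")
      case True
      then have "card u = Suc (card (u - {a}))"
        using \<open>finite u\<close> by (simp only: card.remove)
      with True show ?thesis by (simp add: t_def del: card_Diff_insert)
    next
      case False
      with \<open>finite u\<close> show ?thesis by (simp add: t_def)
    qed
  qed
  have "(\<Sum>u\<in>?S. (-1) ^ card u) = (\<Sum>u\<in>?S. (-1) ^ card (t u) :: real)"
    by (rule sum.reindex_bij_witness[of _ t t]) (simp_all only: mem_Collect_eq t_t t_mem)
  also have "\<dots> = - (\<Sum>u\<in>?S. (-1) ^ card u)"
    using sign by (simp add: sum_negf)
  finally show ?thesis using False by simp
qed

definition zeta :: "'a set \<Rightarrow> 'a set \<Rightarrow> real" where
  "zeta x u = (if u \<subseteq> x then 1 else 0)"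

definition moebius :: "'a set \<Rightarrow> 'a set \<Rightarrow> real" where
  "moebius x u = (if u \<subseteq> x then (-1) ^ (card x + card u) else 0)"

lemma simplicial_complexD:
  assumes "finite_simplicial_complex G"
  shows "finite G" and "{} \<notin> G" and "x \<in> G \<Longrightarrow> finite x"
    and "x \<in> G \<Longrightarrow> u \<subseteq> x \<Longrightarrow> u \<noteq> {} \<Longrightarrow> u \<in> G"
  using assms unfolding finite_simplicial_complex_def by blast+

text \<open>
  As \<open>G\<close> is closed under non-empty subsets and \<open>y \<noteq> {}\<close>, every set between \<open>y\<close> and \<open>x\<close> lies
  in \<open>G\<close>: the sum runs over a whole interval of sets and collapses to its diagonal value.
\<close>

lemma zeta_moebius_inverse:
  assumes "finite_simplicial_complex G" and "x \<in> G" and "y \<in> G"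
  shows "(\<Sum>u\<in>G. zeta x u * moebius u y) = (if x = y then 1 else 0)"
proof -
  have fin: "finite G" "finite x" and "y \<noteq> {}"
    using simplicial_complexD(1-3)[OF assms(1)] assms(2,3) by metis+
  have sub: "u \<in> G" if "y \<subseteq> u" "u \<subseteq> x" for u
  proof -
    from that \<open>y \<noteq> {}\<close> have "u \<noteq> {}" by auto
    with that show ?thesis by (intro simplicial_complexD(4)[OF assms(1,2)])
  qed
  have "(\<Sum>u\<in>G. zeta x u * moebius u y) =
      (\<Sum>u\<in>{u. y \<subseteq> u \<and> u \<subseteq> x}. (-1) ^ card y * (-1) ^ card u)"
    using fin(1) sub
    by (intro sum.mono_neutral_cong_right) (auto simp: zeta_def moebius_def power_add)
  also have "\<dots> = (-1) ^ card y * (\<Sum>u | y \<subseteq> u \<and> u \<subseteq> x. (-1) ^ card u)"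
    by (simp add: sum_distrib_left)
  also have "\<dots> = (if x = y then 1 else 0)"
  proof (cases "y \<subseteq> x")
    case True
    then show ?thesis
      by (simp add: alternating_sum_interval[OF fin(2)] flip: power_mult_distrib)
  next
    case False
    then have empty: "{u. y \<subseteq> u \<and> u \<subseteq> x} = {}" by blast
    from False show ?thesis unfolding empty by auto
  qed
  finally show ?thesis .
qed

text \<open>
  The elements of \<open>G\<close> below \<open>x\<close> are all subsets of \<open>x\<close> but the empty one. The alternating sum over
  all subsets vanishes, so what remains is the negative of the term of the empty set.
\<close>

lemma moebius_row_sum:
  assumes "finite_simplicial_complex G" and "x \<in> G"
  shows "(\<Sum>u\<in>G. moebius x u) = - ((-1) ^ card x)"
proof -
  have fin: "finite G" "finite x" and "x \<noteq> {}"
    using simplicial_complexD(1-3)[OF assms(1)] assms(2) by metis+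
  have sub: "u \<in> G" if "u \<noteq> {}" "u \<subseteq> x" for u
    using that by (intro simplicial_complexD(4)[OF assms])
  have "{} \<notin> G"
    by (rule simplicial_complexD(2)[OF assms(1)])
  then have "(\<Sum>u\<in>G. moebius x u) = (\<Sum>u\<in>{u. {} \<subseteq> u \<and> u \<subseteq> x} - {{}}. (-1) ^ card x * (-1) ^ card u)"
    using fin(1) sub
    by (intro sum.mono_neutral_cong_right) (auto simp: moebius_def power_add)
  also have "\<dots> = (-1) ^ card x * (\<Sum>u\<in>{u. {} \<subseteq> u \<and> u \<subseteq> x} - {{}}. (-1) ^ card u)"
    by (simp add: sum_distrib_left)
  also have "(\<Sum>u\<in>{u. {} \<subseteq> u \<and> u \<subseteq> x} - {{}}. (-1) ^ card u) = (-1 :: real)"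
    using alternating_sum_interval[of x "{}"] fin(2) \<open>x \<noteq> {}\<close>
    by (subst sum_diff1) auto
  finally show ?thesis by simp
qed

lemma card_core_Int:
  assumes "finite G"
  shows "real (card (core G x \<inter> core G y)) = (\<Sum>u\<in>G. zeta x u * zeta y u)"
proof -
  have "(\<Sum>u\<in>G. zeta x u * zeta y u) = (\<Sum>u\<in>core G x \<inter> core G y. 1)"
    using assms by (intro sum.mono_neutral_cong_right) (auto simp: core_def zeta_def)
  then show ?thesis by simp
qed

text \<open>
  Products of matrices indexed through \<open>xs\<close> turn into sums over \<open>set xs\<close>, so that identities between
  such matrices can be proved as identities about sums over the complex.
\<close>

definition enum_mat :: "'a set list \<Rightarrow> ('a set \<Rightarrow> 'a set \<Rightarrow> real) \<Rightarrow> real mat" where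
  "enum_mat xs f = mat (length xs) (length xs) (\<lambda>(i, j). f (xs ! i) (xs ! j))"

lemma enum_mat_carrier [simp]: "enum_mat xs f \<in> carrier_mat (length xs) (length xs)"
  by (simp add: enum_mat_def)

lemma transpose_enum_mat: "transpose_mat (enum_mat xs f) = enum_mat xs (\<lambda>x y. f y x)"
  by (rule eq_matI) (auto simp: enum_mat_def)

lemma sum_list_indices:
  assumes "distinct xs"
  shows "(\<Sum>i<length xs. f (xs ! i)) = sum f (set xs)"
  by (rule sum.reindex_bij_betw) (rule bij_betw_nth[OF assms refl refl])

lemma enum_mat_mult:
  assumes "distinct xs"
  shows "enum_mat xs f * enum_mat xs g = enum_mat xs (\<lambda>x y. \<Sum>u\<in>set xs. f x u * g u y)"
proof (rule eq_matI, goal_cases)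
  case (1 i j)
  then show ?case
    using sum_list_indices[OF assms, of "\<lambda>u. f (xs ! i) u * g u (xs ! j)"]
    by (simp add: enum_mat_def scalar_prod_def atLeast0LessThan)
qed (auto simp: enum_mat_def)

lemma sum_entries_gram:
  fixes m :: "'b \<Rightarrow> 'b \<Rightarrow> real"
  shows "(\<Sum>x\<in>A. \<Sum>y\<in>A. \<Sum>u\<in>A. m u x * m u y) = (\<Sum>u\<in>A. (\<Sum>x\<in>A. m u x)\<^sup>2)"
proof -
  have "(\<Sum>x\<in>A. \<Sum>y\<in>A. \<Sum>u\<in>A. m u x * m u y) = (\<Sum>x\<in>A. \<Sum>u\<in>A. \<Sum>y\<in>A. m u x * m u y)"
    by (intro sum.cong refl sum.swap)
  also have "\<dots> = (\<Sum>u\<in>A. \<Sum>x\<in>A. \<Sum>y\<in>A. m u x * m u y)"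
    by (rule sum.swap)
  finally show ?thesis
    by (simp add: power2_eq_square sum_product)
qed

theorem theorem4:
  fixes G :: "'a set set" and xs :: "'a set list"
  assumes "finite_simplicial_complex G"
    and "distinct xs" and "set xs = G"
  shows "invertible_mat (counting_matrix G xs) \<and>
    (\<forall>L. inverts_mat (counting_matrix G xs) L \<and> inverts_mat L (counting_matrix G xs) \<longrightarrow>
       (\<Sum>i<length xs. \<Sum>j<length xs. L $$ (i, j)) = real (card G))"
proof -
  define n where "n = length xs"
  define K where "K = counting_matrix G xs"
  define Z where "Z = enum_mat xs zeta"
  define M where "M = enum_mat xs moebius"
  define N where "N = transpose_mat M * M"
  note assms(3)[simp]
  have carr [simp]: "K \<in> carrier_mat n n" "Z \<in> carrier_mat n n" "M \<in> carrier_mat n n"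
      "N \<in> carrier_mat n n"
    by (auto simp: K_def Z_def M_def N_def n_def counting_matrix_def enum_mat_def)
  note dims = carr[THEN carrier_matD(1)] carr[THEN carrier_matD(2)]
  have ZM: "Z * M = 1\<^sub>m n"
  proof (rule eq_matI, goal_cases)
    case (1 i j)
    then have "xs ! i \<in> G" "xs ! j \<in> G"
      by (simp_all add: n_def flip: assms(3))
    with 1 show ?case
      using zeta_moebius_inverse[OF assms(1)] nth_eq_iff_index_eq[OF assms(2)]
      by (simp add: Z_def M_def enum_mat_mult[OF assms(2)]) (simp add: enum_mat_def n_def)
  qed (auto simp: Z_def M_def n_def enum_mat_def)
  then have MZ: "M * Z = 1\<^sub>m n"
    by (rule mat_mult_left_right_inverse[rotated 2]) simp_all
  have "finite G"
    by (rule simplicial_complexD(1)[OF assms(1)])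
  then have K: "K = Z * transpose_mat Z"
    unfolding K_def Z_def transpose_enum_mat enum_mat_mult[OF assms(2)] counting_matrix_def
    by (simp add: enum_mat_def card_core_Int)
  have "K * N = Z * ((transpose_mat Z * transpose_mat M) * M)"
    using carr(4) by (simp add: K N_def assoc_mult_mat[of _ n n _ n _ n])
  also have "transpose_mat Z * transpose_mat M = transpose_mat (M * Z)"
    by (rule transpose_mult[symmetric, of _ n n _ n]) simp_all
  also have "Z * (transpose_mat (M * Z) * M) = 1\<^sub>m n"
    by (simp add: MZ ZM left_mult_one_mat[of _ n n])
  finally have KN: "K * N = 1\<^sub>m n" .
  then have NK: "N * K = 1\<^sub>m n"
    by (rule mat_mult_left_right_inverse[rotated 2]) simp_all
  have inv: "invertible_mat K"
    unfolding invertible_mat_def inverts_mat_def using KN NK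
    by (auto simp: dims intro!: exI[of _ N])
  have "(\<Sum>i<length xs. \<Sum>j<length xs. L $$ (i, j)) = real (card G)"
    if "inverts_mat K L" "inverts_mat L K" for L
  proof -
    have KL: "K * L = 1\<^sub>m n" and LK: "L * K = 1\<^sub>m (dim_row L)"
      using that by (simp_all add: inverts_mat_def dims)
    have [simp]: "L \<in> carrier_mat n n"
      using arg_cong[OF KL, of dim_col] arg_cong[OF LK, of dim_col] by (auto simp: dims)
    \<comment> \<open>A right inverse of \<open>K\<close> coincides with any left inverse, here \<open>N\<close>.\<close>
    have "L = (N * K) * L"
      by (simp add: NK left_mult_one_mat[of _ n n])
    also have "\<dots> = N"
      by (simp add: assoc_mult_mat[of _ n n _ n _ n] KL right_mult_one_mat[of _ n n])
    finally have L: "L = enum_mat xs (\<lambda>x y. \<Sum>u\<in>G. moebius u x * moebius u y)"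
      unfolding N_def M_def transpose_enum_mat enum_mat_mult[OF assms(2)] by simp
    have "(\<Sum>i<length xs. \<Sum>j<length xs. L $$ (i, j)) =
        (\<Sum>i<length xs. \<Sum>j<length xs. \<Sum>u\<in>G. moebius u (xs ! i) * moebius u (xs ! j))"
      by (simp add: L enum_mat_def)
    also have "\<dots> = (\<Sum>x\<in>G. \<Sum>y\<in>G. \<Sum>u\<in>G. moebius u x * moebius u y)"
      using sum_list_indices[OF assms(2), of "\<lambda>y. \<Sum>u\<in>G. moebius u x * moebius u y" for x]
        sum_list_indices[OF assms(2), of "\<lambda>x. \<Sum>y\<in>G. \<Sum>u\<in>G. moebius u x * moebius u y"]
      by simp
    also have "\<dots> = (\<Sum>u\<in>G. (\<Sum>x\<in>G. moebius u x)\<^sup>2)"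
      by (rule sum_entries_gram)
    also have "\<dots> = (\<Sum>u\<in>G. 1)"
      by (rule sum.cong) (simp_all add: moebius_row_sum[OF assms(1)] flip: power_mult)
    finally show ?thesis by simp
  qed
  with inv show ?thesis
    unfolding K_def by blast
qed

end
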